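(* The set $S_0^{3,ntr}$ includes a primitive element (over $\mathbb{Q}$) of any real cubic field which is not totally real. The same is true of $S_{-3}^{3,ntr}$.
   Context: A real cubic field is a subfield of $\mathbb{R}$ of degree three over $\mathbb{Q}$; it is totally real if all of its embeddings into $\mathbb{C}$ have image in $\mathbb{R}$. For integers $m, n$ satisfying $m^2-3n \le 0$ and $m+n \ge 1$, define $$I_{m,n}^{3,ntr} := \{\alpha \in (0,1) \mid \alpha^3+m\alpha^2+n\alpha+d=0 \text{ for some } d \in \mathbb{Z},\ -(m+n) \le d \le -1\}.$$ For $m \in \{0,-1,-2,-3\}$, define $$S_m^{3,ntr} := \bigcup_{n \ge -m+1} I_{m,n}^{3,ntr}.$$ *)

theory Defs
  imports Complex_Main "HOL-Algebra.Algebra" "HOL-Algebra.Algebraic_Closure_Type"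
begin

abbreviation real_ring :: "real ring" where
  "real_ring \<equiv> ring_of_type_algebra"

abbreviation complex_ring :: "complex ring" where
  "complex_ring \<equiv> ring_of_type_algebra"

definition real_cubic_field :: "real set \<Rightarrow> bool" where
  "real_cubic_field K \<longleftrightarrow> subfield K real_ring \<and> ring.dimension real_ring 3 \<rat> K"

text \<open>Elements of \<open>ring_hom\<close> preserve 1, so on a field they are automatically injective.
  They are total functions on the reals, of which only the restriction to \<open>K\<close> matters.\<close>

definition field_embeddings :: "real set \<Rightarrow> (real \<Rightarrow> complex) set" where
  "field_embeddings K = ring_hom (real_ring\<lparr>carrier := K\<rparr>) complex_ring"

definition totally_real :: "real set \<Rightarrow> bool" where
  "totally_real K \<longleftrightarrow> (\<forall>\<sigma>\<in>field_embeddings K. \<sigma> ` K \<subseteq> \<real>)"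

definition primitive_element :: "real \<Rightarrow> real set \<Rightarrow> bool" where
  "primitive_element \<alpha> K \<longleftrightarrow> \<alpha> \<in> K \<and> generate_field real_ring (\<rat> \<union> {\<alpha>}) = K"

text \<open>\<open>I_ntr m n\<close> is only meant for \<open>m\<^sup>2 - 3 * n \<le> 0\<close> and \<open>m + n \<ge> 1\<close>. By the lemma below,
  all the sets entering \<open>S_ntr m\<close> for \<open>m \<in> {0, -1, -2, -3}\<close> satisfy this.\<close>

definition I_ntr :: "int \<Rightarrow> int \<Rightarrow> real set" where
  "I_ntr m n = {\<alpha> \<in> {0<..<1}. \<exists>d::int. - (m + n) \<le> d \<and> d \<le> -1 \<and>
     \<alpha> ^ 3 + of_int m * \<alpha> ^ 2 + of_int n * \<alpha> + of_int d = 0}"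

definition S_ntr :: "int \<Rightarrow> real set" where
  "S_ntr m = (\<Union>n\<in>{- m + 1..}. I_ntr m n)"

lemma I_ntr_admissible:
  fixes m n :: int
  assumes "m \<in> {0, -1, -2, -3}" and "n \<ge> - m + 1"
  shows "m ^ 2 - 3 * n \<le> 0" and "m + n \<ge> 1"
  using assms by auto

end

theory Submission
  imports Defs "HOL-Analysis.Kronecker_Approximation_Theorem"
begin

text \<open>If \<open>g\<close> in \<open>K\<close> is an irrational algebraic integer of trace zero, with \<open>g\<^sup>3 + p g + q = 0\<close>, then
  so is every nonzero integer combination of \<open>g\<close> and \<open>3 g\<^sup>2 + 2 p\<close>. As the ratio of these two numbers
  is irrational, such a combination \<open>x\<close> with \<open>0 < x < 1\<close> exists by Dirichlet approximation.
  Say \<open>x\<^sup>3 + n x + d = 0\<close>. The conjugates of \<open>x\<close> are not real, so \<open>3 x\<^sup>2 + 4 n > 0\<close>, which gives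
  \<open>n \<ge> 0\<close>; now \<open>0 < - d = x\<^sup>3 + n x < n + 1\<close> puts \<open>x\<close> into \<open>S_ntr 0\<close>. The reflection \<open>1 - x\<close>,
  of trace 3, lies in \<open>S_ntr (-3)\<close>.\<close>

section \<open>The reals as a ring with carrier\<close>

interpretation real_ring: cring real_ring
  by (rule cring_from_type_algebra)

lemma real_ring_simps [simp]:
  "carrier real_ring = (UNIV :: real set)"
  "x \<otimes>\<^bsub>real_ring\<^esub> y = x * y"
  "x \<oplus>\<^bsub>real_ring\<^esub> y = x + y"
  "\<one>\<^bsub>real_ring\<^esub> = (1 :: real)"
  "\<zero>\<^bsub>real_ring\<^esub> = (0 :: real)"
  by (simp_all add: ring_of_type_algebra_def)

lemma real_ring_a_inv [simp]: "\<ominus>\<^bsub>real_ring\<^esub> x = - (x :: real)"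
  by (rule sym, rule real_ring.sum_zero_eq_neg) simp_all

lemma real_ring_m_inv:
  assumes "(x :: real) \<noteq> 0"
  shows "inv\<^bsub>real_ring\<^esub> x = inverse x"
  by (rule real_ring.comm_inv_char) (use assms in simp_all)

lemma subfield_Rats: "subfield \<rat> real_ring"
  by (intro field.subfieldI'[OF field_from_type_algebra] real_ring.subringI) (auto simp: real_ring_m_inv)

lemma Span_Rats_Nil: "real_ring.Span \<rat> [] = {0}"
  by simp

lemma Span_Rats_Cons:
  "x \<in> real_ring.Span \<rat> (u # us) \<longleftrightarrow> (\<exists>a\<in>\<rat>. \<exists>v\<in>real_ring.Span \<rat> us. x = a * u + v)"
  by (simp add: real_ring.line_extension_mem_iff)

lemma Span_Rats_pair:
  "x \<in> real_ring.Span \<rat> [u, v] \<longleftrightarrow> (\<exists>a\<in>\<rat>. \<exists>b\<in>\<rat>. x = a * u + b * v)"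
  unfolding Span_Rats_Cons[of x u] Bex_def Span_Rats_Cons[of _ v] Span_Rats_Nil by force

lemma Span_Rats_triple:
  "x \<in> real_ring.Span \<rat> [u, v, w] \<longleftrightarrow>
    (\<exists>a\<in>\<rat>. \<exists>b\<in>\<rat>. \<exists>c\<in>\<rat>. x = a * u + b * v + c * w)"
  unfolding Span_Rats_Cons[of x u] Bex_def Span_Rats_pair by (force simp: add.assoc)

lemma independent_Rats_Cons:
  assumes "real_ring.independent \<rat> us" and "u \<notin> real_ring.Span \<rat> us"
  shows "real_ring.independent \<rat> (u # us)"
  by (rule real_ring.li_Cons) (use assms in auto)

section \<open>Cubic fields\<close>

context
  fixes K :: "real set"
  assumes K: "real_cubic_field K"
begin

lemma cubic_subfield: "subfield K real_ring"
  using K by (simp add: real_cubic_field_def)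

lemma cubic_dimension: "real_ring.dimension 3 \<rat> K"
  using K by (simp add: real_cubic_field_def)

lemma cubic_closed:
  shows one_in_cubic: "1 \<in> K"
    and add_in_cubic: "x \<in> K \<Longrightarrow> y \<in> K \<Longrightarrow> x + y \<in> K"
    and mult_in_cubic: "x \<in> K \<Longrightarrow> y \<in> K \<Longrightarrow> x * y \<in> K"
  using subringE(3,6,7)[OF subfieldE(1)[OF cubic_subfield]] by simp_all

text \<open>\<open>K\<close> is closed under rational scaling as a vector space, and it contains
  1.\<close>

lemma Rats_in_cubic: "x \<in> \<rat> \<Longrightarrow> x \<in> K"
  using real_ring.space_subgroup_props(5)[OF subfield_Rats cubic_dimension, of x 1] one_in_cubic
  by simp

lemma diff_in_cubic: "x \<in> K \<Longrightarrow> y \<in> K \<Longrightarrow> x - y \<in> K"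
  using add_in_cubic[of x "- 1 * y"] mult_in_cubic[of "- 1" y] Rats_in_cubic[of "- 1"] by simp

lemma power_in_cubic: "x \<in> K \<Longrightarrow> x ^ k \<in> K"
  by (induction k) (auto intro: one_in_cubic mult_in_cubic)

lemmas in_cubic = one_in_cubic add_in_cubic mult_in_cubic Rats_in_cubic diff_in_cubic power_in_cubic

lemma independent_one_irrational:
  assumes "x \<notin> \<rat>"
  shows "real_ring.independent \<rat> [x, 1]"
proof -
  have "real_ring.independent \<rat> [1]"
    by (rule independent_Rats_Cons) auto
  moreover have "x \<notin> real_ring.Span \<rat> [1]"
    unfolding Span_Rats_Cons Span_Rats_Nil using assms by auto
  ultimately show ?thesis
    by (rule independent_Rats_Cons)
qed

text \<open>A quadratic irrationality \<open>x\<close> in \<open>K\<close> would produce, together with any \<open>y\<close> of \<open>K\<close> outside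
  the field \<open>\<rat> + \<rat> x\<close>, the four independent elements \<open>1, x, y, x y\<close>.\<close>

lemma square_notin_Span:
  assumes "x \<in> K" "x \<notin> \<rat>"
  shows "x\<^sup>2 \<notin> real_ring.Span \<rat> [x, 1]"
proof
  assume "x\<^sup>2 \<in> real_ring.Span \<rat> [x, 1]"
  then obtain u v where uv: "u \<in> \<rat>" "v \<in> \<rat>" "x\<^sup>2 = u * x + v"
    unfolding Span_Rats_pair by auto
  have ind: "real_ring.independent \<rat> [x, 1]"
    using assms(2) by (rule independent_one_irrational)
  have "real_ring.Span \<rat> [x, 1] \<noteq> K"
    using real_ring.independent_length_eq_dimension[OF subfield_Rats cubic_dimension ind]
      assms(1) one_in_cubic by simp
  moreover have "real_ring.Span \<rat> [x, 1] \<subseteq> K"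
    using assms(1) unfolding subset_iff Span_Rats_pair
    by (auto intro!: add_in_cubic mult_in_cubic intro: Rats_in_cubic)
  ultimately obtain y where y: "y \<in> K" "y \<notin> real_ring.Span \<rat> [x, 1]"
    by auto
  have "x * y \<notin> real_ring.Span \<rat> [y, x, 1]"
  proof
    assume "x * y \<in> real_ring.Span \<rat> [y, x, 1]"
    then obtain a b c where abc: "a \<in> \<rat>" "b \<in> \<rat>" "c \<in> \<rat>" "x * y = a * y + b * x + c"
      unfolding Span_Rats_triple by auto
    \<comment> \<open>In \<rat> + \<rat>\<open>x\<close> the conjugate of \<open>x\<close> is
      \<open>u - x\<close>, so \<open>N\<close> is minus the norm of \<open>x - a\<close>.
      Multiplying by \<open>x - u + a\<close> thus clears the denominator of
      \<open>y = (b * x + c) / (x - a)\<close>.\<close>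
    define N where "N = v + u * a - a\<^sup>2"
    have N_eq: "(x - a) * (x - u + a) = N"
      using uv(3) by (simp add: N_def algebra_simps power2_eq_square)
    have "x \<noteq> a" "x \<noteq> u - a"
      using assms(2) abc(1) uv(1) by auto
    then have "N \<noteq> 0"
      using N_eq by (metis add_diff_cancel_left' diff_add_eq diff_diff_eq2 eq_iff_diff_eq_0 mult_eq_0_iff)
    have "N * y = (b * x + c) * (x - u + a)"
    proof -
      have "(x - a) * y = b * x + c"
        using abc(4) by (simp add: algebra_simps)
      then show ?thesis
        unfolding N_eq[symmetric] by (simp add: mult_ac)
    qed
    also have "\<dots> = b * (x\<^sup>2 - u * x) + (b * a + c) * x - c * (u - a)"
      by (simp add: algebra_simps power2_eq_square)
    also have "\<dots> = (b * a + c) * x + (b * v - c * (u - a))"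
      using uv(3) by simp
    finally have "y = (b * a + c) / N * x + (b * v - c * (u - a)) / N * 1"
      using \<open>N \<noteq> 0\<close> by (simp add: field_simps)
    moreover have "N \<in> \<rat>"
      using uv abc by (auto simp: N_def power2_eq_square)
    ultimately have "y \<in> real_ring.Span \<rat> [x, 1]"
      unfolding Span_Rats_pair using uv(1,2) abc(1-3)
      by (intro bexI[of _ "(b * a + c) / N"] bexI[of _ "(b * v - c * (u - a)) / N"]) auto
    with y(2) show False ..
  qed
  then have "real_ring.independent \<rat> [x * y, y, x, 1]"
    using independent_Rats_Cons ind y(2) by blast
  then show False
    using real_ring.independent_length_le_dimension[OF subfield_Rats cubic_dimension, of "[x * y, y, x, 1]"]
      assms(1) y(1) by (simp add: one_in_cubic mult_in_cubic)
qed

text \<open>Three independent elements of a space of dimension three span it.\<close>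

lemma cubic_Span:
  assumes "x \<in> K" "x \<notin> \<rat>"
  shows "real_ring.Span \<rat> [x\<^sup>2, x, 1] = K"
proof -
  have ind: "real_ring.independent \<rat> [x\<^sup>2, x, 1]"
    using independent_Rats_Cons independent_one_irrational square_notin_Span assms by blast
  show "real_ring.Span \<rat> [x\<^sup>2, x, 1] = K"
    using real_ring.independent_length_eq_dimension[OF subfield_Rats cubic_dimension ind] assms(1)
    by (simp add: one_in_cubic power_in_cubic)
qed

lemma cubic_coordinates:
  assumes "x \<in> K" "x \<notin> \<rat>" "y \<in> K"
  obtains a b c where "a \<in> \<rat>" "b \<in> \<rat>" "c \<in> \<rat>" "y = a * x\<^sup>2 + b * x + c"
  using assms(3) unfolding cubic_Span[OF assms(1,2), symmetric] Span_Rats_triple by auto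

text \<open>A relation with \<open>a\<close> nonzero would express \<open>x\<^sup>2\<close> through
  \<open>x\<close> and 1; one with only \<open>b\<close> nonzero would make \<open>x\<close>
  rational.\<close>

lemma cubic_no_quadratic_relation:
  assumes x: "x \<in> K" "x \<notin> \<rat>" and abc: "a \<in> \<rat>" "b \<in> \<rat>" "c \<in> \<rat>"
    and eq: "a * x\<^sup>2 + b * x + c = 0"
  shows "a = 0" "b = 0" "c = 0"
proof -
  show "a = 0"
  proof (rule ccontr)
    assume "a \<noteq> 0"
    then have "x\<^sup>2 = (- b / a) * x + (- c / a) * 1"
      using eq by (simp add: field_simps)
    then have "x\<^sup>2 \<in> real_ring.Span \<rat> [x, 1]"
      unfolding Span_Rats_pair using abc
      by (intro bexI[of _ "- b / a"] bexI[of _ "- c / a"]) auto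
    with square_notin_Span[OF x] show False ..
  qed
  show "b = 0"
  proof (rule ccontr)
    assume "b \<noteq> 0"
    then have "x = - c / b"
      using eq \<open>a = 0\<close> by (simp add: field_simps)
    with abc x(2) show False by auto
  qed
  with eq \<open>a = 0\<close> show "c = 0" by simp
qed

text \<open>The coordinates with respect to \<open>x\<^sup>2\<close>, \<open>x\<close>, 1 build
  every element of \<open>K\<close> from \<open>x\<close> and rationals by sums and
  products.\<close>

lemma primitive_element_cubic:
  assumes "x \<in> K" "x \<notin> \<rat>"
  shows "primitive_element x K"
proof -
  let ?G = "generate_field real_ring (\<rat> \<union> {x})"
  have "K \<subseteq> ?G"
  proof
    fix y assume "y \<in> K"
    then obtain a b c where abc: "a \<in> \<rat>" "b \<in> \<rat>" "c \<in> \<rat>" "y = a * (x * x) + b * x + c"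
      using cubic_coordinates[OF assms] by (metis power2_eq_square)
    have incl: "z \<in> ?G" if "z \<in> \<rat> \<union> {x}" for z
      using that by (rule generate_field.incl)
    have mult: "z * w \<in> ?G" if "z \<in> ?G" "w \<in> ?G" for z w
      using generate_field.eng_mult[OF that] by simp
    have add: "z + w \<in> ?G" if "z \<in> ?G" "w \<in> ?G" for z w
      using generate_field.eng_add[OF that] by simp
    show "y \<in> ?G"
      unfolding abc(4) by (intro add mult incl) (use abc in auto)
  qed
  moreover have "?G \<subseteq> K"
    by (rule field.generate_field_min_subfield1[OF field_from_type_algebra]) (use cubic_subfield assms Rats_in_cubic in auto)
  ultimately show ?thesis
    using assms(1) unfolding primitive_element_def by blast
qed

lemma cubic_irrational:
  obtains x where "x \<in> K" "x \<notin> \<rat>"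
proof -
  have "\<not> K \<subseteq> \<rat>"
  proof
    assume "K \<subseteq> \<rat>"
    with Rats_in_cubic have "K = \<rat>" by auto
    then show False
      using real_ring.dimension_is_inj[OF subfield_Rats cubic_dimension]
        real_ring.dimension_one[OF subfield_Rats] by fastforce
  qed
  with that show thesis by auto
qed

section \<open>Embeddings and integers of trace zero\<close>

lemma embedding_hom:
  assumes "\<sigma> \<in> field_embeddings K"
  shows embedding_add: "x \<in> K \<Longrightarrow> y \<in> K \<Longrightarrow> \<sigma> (x + y) = \<sigma> x + \<sigma> y"
    and embedding_mult: "x \<in> K \<Longrightarrow> y \<in> K \<Longrightarrow> \<sigma> (x * y) = \<sigma> x * \<sigma> y"
    and embedding_one: "\<sigma> 1 = 1"
  using assms
  by (auto simp: field_embeddings_def ring_hom_def ring_of_type_algebra_def)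

lemma embedding_of_int:
  assumes "\<sigma> \<in> field_embeddings K"
  shows "\<sigma> (of_int k) = of_int k"
proof -
  note add = embedding_add[OF assms] and one = embedding_one[OF assms]
  have zero: "\<sigma> 0 = 0"
    using add[of 0 0] Rats_in_cubic[of 0] by simp
  have nat: "\<sigma> (of_nat m) = of_nat m" for m
    by (induction m) (auto simp: zero one add one_in_cubic Rats_in_cubic)
  show ?thesis
  proof (cases k)
    case (nonneg m)
    then show ?thesis by (simp add: nat)
  next
    case (neg m)
    have "\<sigma> (of_int k) + \<sigma> (of_nat (Suc m)) = \<sigma> (of_int k + of_nat (Suc m))"
      by (rule add[symmetric]) (auto intro!: Rats_in_cubic simp del: of_nat_Suc)
    also have "of_int k + of_nat (Suc m) = (0 :: real)"
      by (simp add: neg)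
    finally show ?thesis
      by (simp add: nat zero neg eq_neg_iff_add_eq_0 del: of_nat_Suc)
  qed
qed

text \<open>Since elements of \<open>K\<close> have rational coordinates in the powers of an
  irrational \<open>x\<close>, this traces a nonreal value of \<sigma> back to a nonreal
  \<open>\<sigma> x\<close>.\<close>

lemma embedding_Rats:
  assumes "\<sigma> \<in> field_embeddings K" "x \<in> \<rat>"
  shows "\<sigma> x \<in> \<real>"
proof -
  obtain a b :: int where ab: "b > 0" "x = of_int a / of_int b"
    using assms(2) by (rule Rats_cases')
  have "\<sigma> x * \<sigma> (of_int b) = \<sigma> (x * of_int b)"
    by (rule embedding_mult[OF assms(1), symmetric]) (use assms(2) in \<open>auto intro: Rats_in_cubic\<close>)
  also have "x * of_int b = of_int a"
    using ab by simp
  finally have "\<sigma> x = of_int a / of_int b"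
    using ab(1) by (simp add: embedding_of_int[OF assms(1)] field_simps)
  then show ?thesis by simp
qed

text \<open>Dividing the cubic by its linear factor at \<open>x\<close> leaves a quadratic of
  discriminant \<open>- (3 * x\<^sup>2 + 4 * n)\<close>, which has the nonreal root
  \<open>\<sigma> x\<close>.\<close>

lemma discriminant_nonreal_conjugate:
  fixes n d :: int
  assumes not_real: "\<not> totally_real K"
    and x: "x \<in> K" "x \<notin> \<rat>" and root: "x ^ 3 + of_int n * x + of_int d = 0"
  shows "3 * x\<^sup>2 + 4 * of_int n > 0"
proof -
  obtain \<sigma> y where \<sigma>: "\<sigma> \<in> field_embeddings K" and y: "y \<in> K" "\<sigma> y \<notin> \<real>"
    using not_real unfolding totally_real_def by auto
  note emb = embedding_add[OF \<sigma>] embedding_mult[OF \<sigma>] embedding_of_int[OF \<sigma>]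
  obtain a b c where abc: "a \<in> \<rat>" "b \<in> \<rat>" "c \<in> \<rat>" "y = a * (x * x) + b * x + c"
    using cubic_coordinates[OF x y(1)] by (metis power2_eq_square)
  define z where "z = \<sigma> x"
  have "\<sigma> y = \<sigma> a * (z * z) + \<sigma> b * z + \<sigma> c"
    using x(1) abc by (simp add: emb in_cubic z_def)
  with y(2) have "z \<notin> \<real>"
    using embedding_Rats[OF \<sigma>] abc by auto
  have "\<sigma> (x * (x * x) + of_int n * x + of_int d) = z * (z * z) + of_int n * z + of_int d"
    using x(1) by (simp add: emb in_cubic z_def)
  moreover have "x * (x * x) + of_int n * x + of_int d = of_int 0"
    using root by (simp add: power3_eq_cube)
  ultimately have z_root: "z * (z * z) + of_int n * z + of_int d = 0"
    using embedding_of_int[OF \<sigma>, of 0] by simp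
  have "complex_of_real (x ^ 3 + of_int n * x + of_int d) = 0"
    unfolding root by simp
  then have "of_real x ^ 3 + of_int n * of_real x + of_int d = (0 :: complex)"
    by simp
  moreover have "(z - of_real x) * (z\<^sup>2 + of_real x * z + of_real x ^ 2 + of_int n) =
      (z * (z * z) + of_int n * z + of_int d) - (of_real x ^ 3 + of_int n * of_real x + of_int d)"
    by (simp add: algebra_simps power2_eq_square power3_eq_cube)
  ultimately have "(z - of_real x) * (z\<^sup>2 + of_real x * z + of_real x ^ 2 + of_int n) = 0"
    using z_root by simp
  moreover have "z \<noteq> of_real x"
    using \<open>z \<notin> \<real>\<close> by auto
  ultimately have quad: "z\<^sup>2 + of_real x * z + of_real x ^ 2 + of_int n = 0"
    by simp
  have "Im z \<noteq> 0"
    using \<open>z \<notin> \<real>\<close> by (simp add: complex_is_Real_iff)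
  \<comment> \<open>The imaginary part fixes \<open>Re z\<close>; the real part then shows that the
    negated discriminant is \<open>4 * (Im z)\<^sup>2\<close>.\<close>
  have "Im z * (2 * Re z + x) = 0"
    using arg_cong[OF quad, of Im] by (simp add: power2_eq_square algebra_simps)
  with \<open>Im z \<noteq> 0\<close> have re: "2 * Re z + x = 0"
    by simp
  have "(Re z)\<^sup>2 - (Im z)\<^sup>2 + x * Re z + x\<^sup>2 + of_int n = 0"
    using arg_cong[OF quad, of Re] by (simp add: power2_eq_square algebra_simps)
  moreover have "x = - 2 * Re z"
    using re by simp
  ultimately have "3 * x\<^sup>2 + 4 * of_int n = 4 * (Im z)\<^sup>2"
    by (simp add: power2_eq_square)
  with \<open>Im z \<noteq> 0\<close> show ?thesis
    by simp
qed

section \<open>Construction of a small algebraic integer of trace zero\<close>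

lemma trace_zero_integer:
  obtains g and p q :: int where "g \<in> K" "g \<notin> \<rat>" "g ^ 3 + of_int p * g + of_int q = 0"
proof -
  obtain x where x: "x \<in> K" "x \<notin> \<rat>"
    by (rule cubic_irrational)
  obtain a b c where abc: "a \<in> \<rat>" "b \<in> \<rat>" "c \<in> \<rat>" "x ^ 3 = a * x\<^sup>2 + b * x + c"
    using cubic_coordinates[OF x power_in_cubic[OF x(1)]] by metis
  obtain a1 a2 :: int where a: "a2 > 0" "a = of_int a1 / of_int a2"
    using abc(1) by (rule Rats_cases')
  obtain b1 b2 :: int where b: "b2 > 0" "b = of_int b1 / of_int b2"
    using abc(2) by (rule Rats_cases')
  obtain c1 c2 :: int where c: "c2 > 0" "c = of_int c1 / of_int c2"
    using abc(3) by (rule Rats_cases')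
  \<comment> \<open>Scaling \<open>x\<close> by the common denominator \<open>N\<close> multiplies
    the coefficients \<open>a\<close>, \<open>b\<close>, \<open>c\<close> by \<open>N\<close>,
    \<open>N\<^sup>2\<close>, \<open>N ^ 3\<close>, which makes them integral.\<close>
  define N A B C where "N = a2 * b2 * c2" and "A = a1 * b2 * c2"
    and "B = N * (b1 * a2 * c2)" and "C = N\<^sup>2 * (c1 * a2 * b2)"
  define t where "t = of_int N * x"
  have "N > 0"
    using a b c by (simp add: N_def)
  have coeffs: "of_int A = of_int N * a" "of_int B = of_int N ^ 2 * b" "of_int C = of_int N ^ 3 * c"
    using a b c by (simp_all add: A_def B_def C_def N_def power2_eq_square power3_eq_cube)
  have t: "t ^ 3 = of_int A * t\<^sup>2 + of_int B * t + of_int C"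
    unfolding coeffs t_def power_mult_distrib abc(4)
    by (simp add: algebra_simps power2_eq_square power3_eq_cube)
  \<comment> \<open>The trace of \<open>t\<close> is \<open>A\<close>; tripling \<open>t\<close>
    before subtracting it removes the trace without introducing denominators.\<close>
  define g where "g = 3 * t - of_int A"
  have "g \<in> K"
    unfolding g_def t_def using x(1)
    by (intro diff_in_cubic mult_in_cubic) (auto intro: Rats_in_cubic)
  moreover have "g \<notin> \<rat>"
  proof
    assume "g \<in> \<rat>"
    moreover have "x = (g + of_int A) / (3 * of_int N)"
      using \<open>N > 0\<close> by (simp add: g_def t_def)
    ultimately show False
      using x(2) by simp
  qed
  moreover have "g ^ 3 + of_int (- 3 * A\<^sup>2 - 9 * B) * g + of_int (- 2 * A ^ 3 - 9 * A * B - 27 * C) =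
      27 * (t ^ 3 - (of_int A * t\<^sup>2 + of_int B * t + of_int C))"
    unfolding g_def by (simp add: algebra_simps power2_eq_square power3_eq_cube)
  then have "g ^ 3 + of_int (- 3 * A\<^sup>2 - 9 * B) * g + of_int (- 2 * A ^ 3 - 9 * A * B - 27 * C) = 0"
    unfolding t by simp
  ultimately show thesis
    by (rule that)
qed

text \<open>When \<open>p\<close> is the linear coefficient of the cubic of \<open>g\<close>, the
  trace of \<open>g\<^sup>2\<close> is \<open>- 2 * p\<close>, so
  \<open>3 * g\<^sup>2 + 2 * p\<close> has trace zero. Independence of \<open>g\<^sup>2\<close>,
  \<open>g\<close>, 1 makes every combination with \<open>b\<close> nonzero irrational.\<close>

lemma small_trace_zero_combination:
  fixes p :: int
  assumes g: "g \<in> K" "g \<notin> \<rat>"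
  obtains a b :: int where "0 < of_int a * g + of_int b * (3 * g\<^sup>2 + 2 * of_int p)"
    "of_int a * g + of_int b * (3 * g\<^sup>2 + 2 * of_int p) < 1"
    "of_int a * g + of_int b * (3 * g\<^sup>2 + 2 * of_int p) \<notin> \<rat>"
proof -
  define f where "f a b = of_int a * g + of_int b * (3 * g\<^sup>2 + 2 * of_int p)" for a b :: int
  have irrational: "f a b \<notin> \<rat>" if "b \<noteq> 0" for a b
  proof
    assume "f a b \<in> \<rat>"
    moreover have "3 * of_int b * g\<^sup>2 + of_int a * g + (2 * of_int b * of_int p - f a b) = 0"
      by (simp add: f_def algebra_simps)
    ultimately have "3 * of_int b = (0 :: real)"
      using cubic_no_quadratic_relation(1)[OF g] by (metis Rats_diff Rats_mult Rats_of_int Rats_number_of)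
    with that show False by simp
  qed
  have "g \<noteq> 0"
    using g(2) by auto
  \<comment> \<open>With \<open>N\<close> at least \<bar>\<open>g\<close>\<bar>, the approximation
    error \<open>1 / N\<close> is still at most 1 after multiplication by
    \<bar>\<open>g\<close>\<bar>.\<close>
  define N where "N = nat \<lceil>\<bar>g\<bar>\<rceil>"
  have "N > 0" "\<bar>g\<bar> \<le> N"
    using \<open>g \<noteq> 0\<close> by (auto simp: N_def)
  obtain h k :: int where hk: "0 < k"
    "\<bar>of_int k * ((3 * g\<^sup>2 + 2 * of_int p) / g) - of_int h\<bar> < 1 / N"
    using Dirichlet_approx[OF \<open>N > 0\<close>] by metis
  have "\<bar>f (- h) k\<bar> = \<bar>of_int k * ((3 * g\<^sup>2 + 2 * of_int p) / g) - of_int h\<bar> * \<bar>g\<bar>"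
    using \<open>g \<noteq> 0\<close> by (simp add: f_def abs_mult[symmetric] field_simps)
  also have "\<dots> < 1 / N * \<bar>g\<bar>"
    using hk(2) \<open>g \<noteq> 0\<close> by (intro mult_strict_right_mono) auto
  also have "\<dots> \<le> 1"
    using \<open>N > 0\<close> \<open>\<bar>g\<bar> \<le> N\<close> by simp
  finally have small: "\<bar>f (- h) k\<bar> < 1" .
  \<comment> \<open>Passing to the negative, if necessary, makes the small combination
    positive.\<close>
  have "f h (- k) = - f (- h) k"
    by (simp add: f_def algebra_simps)
  moreover have "f (- h) k \<noteq> 0"
    using irrational[of k "- h"] hk(1) by force
  ultimately obtain a b where "0 < f a b" "f a b < 1" "b \<noteq> 0"
    using small hk(1) by (metis abs_less_iff less_irrefl neg_0_less_iff_less linorder_neqE neg_equal_0_iff_equal)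
  with irrational that show thesis
    unfolding f_def by blast
qed

text \<open>The coefficients are the second elementary symmetric function and the negated norm of
  \<open>a g + b (3 g\<^sup>2 + 2 p)\<close>, expressed through \<open>p\<close> and \<open>q\<close>.\<close>

lemma trace_zero_combination_root:
  fixes g :: real and p q a b :: int
  assumes "g ^ 3 + of_int p * g + of_int q = 0"
  defines "x \<equiv> of_int a * g + of_int b * (3 * g\<^sup>2 + 2 * of_int p)"
  shows "x ^ 3 + of_int (p * a\<^sup>2 + 9 * q * a * b - 3 * p\<^sup>2 * b\<^sup>2) * x +
    of_int (q * a ^ 3 - 2 * p\<^sup>2 * a\<^sup>2 * b - 9 * p * q * a * b\<^sup>2 - (2 * p ^ 3 + 27 * q\<^sup>2) * b ^ 3) = 0"
proof -
  \<comment> \<open>As a polynomial in \<open>g\<close>, the left side is divisible by the cubic of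
    \<open>g\<close>; the second factor is the quotient.\<close>
  have "x ^ 3 + of_int (p * a\<^sup>2 + 9 * q * a * b - 3 * p\<^sup>2 * b\<^sup>2) * x +
      of_int (q * a ^ 3 - 2 * p\<^sup>2 * a\<^sup>2 * b - 9 * p * q * a * b\<^sup>2 - (2 * p ^ 3 + 27 * q\<^sup>2) * b ^ 3) =
    (g ^ 3 + of_int p * g + of_int q) *
      (27 * of_int b ^ 3 * g ^ 3 + 27 * of_int a * of_int b ^ 2 * g\<^sup>2 +
        (27 * of_int p * of_int b ^ 3 + 9 * of_int a ^ 2 * of_int b) * g +
        (of_int a ^ 3 + 9 * of_int p * of_int a * of_int b ^ 2 - 27 * of_int q * of_int b ^ 3))"
    unfolding x_def by (simp add: algebra_simps power2_eq_square power3_eq_cube)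
  with assms(1) show ?thesis
    by simp
qed

lemma small_trace_zero_integer:
  assumes "\<not> totally_real K"
  obtains x and n d :: int where "x \<in> K" "x \<notin> \<rat>" "0 < x" "x < 1" "1 \<le> n" "- n \<le> d" "d \<le> - 1"
    "x ^ 3 + of_int n * x + of_int d = 0"
proof -
  obtain g and p q :: int where g: "g \<in> K" "g \<notin> \<rat>" "g ^ 3 + of_int p * g + of_int q = 0"
    by (rule trace_zero_integer)
  obtain a b :: int where small: "0 < of_int a * g + of_int b * (3 * g\<^sup>2 + 2 * of_int p)"
    "of_int a * g + of_int b * (3 * g\<^sup>2 + 2 * of_int p) < 1"
    "of_int a * g + of_int b * (3 * g\<^sup>2 + 2 * of_int p) \<notin> \<rat>"
    by (rule small_trace_zero_combination[OF g(1,2)])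
  define x where "x = of_int a * g + of_int b * (3 * g\<^sup>2 + 2 * of_int p)"
  have x: "0 < x" "x < 1" "x \<notin> \<rat>"
    using small by (simp_all add: x_def)
  have "x \<in> K"
    unfolding x_def using g(1)
    by (intro add_in_cubic mult_in_cubic power_in_cubic) (auto intro: Rats_in_cubic)
  obtain n d :: int where root: "x ^ 3 + of_int n * x + of_int d = 0"
    using trace_zero_combination_root[OF g(3), of a b] unfolding x_def by metis
  have cube: "0 < x ^ 3" "x ^ 3 < 1"
    using x by (auto simp: power_less_one_iff)
  have "x\<^sup>2 < 1"
    using x by (simp add: power_less_one_iff)
  \<comment> \<open>Here \<open>4 * n > - 3 * x\<^sup>2 > - 3\<close>, and \<open>n\<close> is an
    integer.\<close>
  then have "0 \<le> n"
    using discriminant_nonreal_conjugate[OF assms \<open>x \<in> K\<close> x(3) root] by linarith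
  then have bounds: "0 \<le> of_int n * x" "of_int n * x \<le> of_int n"
    using x by (auto simp: mult_left_le)
  \<comment> \<open>Integrality sharpens both strict bounds by one; together they then force
    \<open>1 \<le> n\<close>.\<close>
  have "real_of_int d < 0" "real_of_int d > - of_int n - 1"
    using root cube bounds by linarith+
  then have "- n \<le> d" "d \<le> - 1"
    by linarith+
  with that[of x n d] \<open>x \<in> K\<close> x root show thesis
    by auto
qed

end

section \<open>Membership of \<open>x\<close> and of its reflection in the two sets\<close>

theorem theorem12:
  fixes K :: "real set"
  assumes "real_cubic_field K" and "\<not> totally_real K"
  shows "(\<exists>\<alpha>\<in>S_ntr 0. primitive_element \<alpha> K) \<and> (\<exists>\<alpha>\<in>S_ntr (-3). primitive_element \<alpha> K)"
proof -
  obtain x and n d :: int where x: "x \<in> K" "x \<notin> \<rat>" "0 < x" "x < 1"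
    and nd: "1 \<le> n" "- n \<le> d" "d \<le> - 1"
    and root: "x ^ 3 + of_int n * x + of_int d = 0"
    by (rule small_trace_zero_integer[OF assms])
  have "x \<in> S_ntr 0"
    using x nd root by (auto simp: S_ntr_def I_ntr_def intro!: bexI[of _ n] exI[of _ d])
  moreover have "1 - x \<in> S_ntr (- 3)"
  proof -
    \<comment> \<open>Substituting \<open>1 - X\<close> into the cubic of \<open>x\<close> and
      negating gives these coefficients. The map from \<open>d\<close> to \<open>- 1 - n - d\<close>
      swaps the ends of the range from \<open>- n\<close> to -1, and \<open>m + n\<close> keeps its
      value.\<close>
    have "(1 - x) ^ 3 + of_int (- 3) * (1 - x) ^ 2 + of_int (n + 3) * (1 - x) + of_int (- 1 - n - d) = 0"
      (is "?l = 0")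
    proof -
      have "?l = - (x ^ 3 + of_int n * x + of_int d)"
        by (simp add: algebra_simps power2_eq_square power3_eq_cube)
      with root show ?thesis by simp
    qed
    then have "1 - x \<in> I_ntr (- 3) (n + 3)"
      using x nd unfolding I_ntr_def by (auto intro!: exI[of _ "- 1 - n - d"])
    then show ?thesis
      using nd unfolding S_ntr_def by (auto intro!: bexI[of _ "n + 3"])
  qed
  moreover have "primitive_element x K"
    using primitive_element_cubic[OF assms(1)] x by blast
  moreover have "1 - x \<notin> \<rat>"
    using x(2) Rats_diff[OF Rats_1, of "1 - x"] by auto
  then have "primitive_element (1 - x) K"
    using primitive_element_cubic[OF assms(1)] diff_in_cubic[OF assms(1)] one_in_cubic[OF assms(1)] x(1)
    by blast
  ultimately show ?thesis
    by blast
qed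

end
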